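(* No mechanism simultaneously satisfies ex-ante favoring-eagerness-for-remaining-items (ea-FERI), strong equal treatment of equals (SETE), and sd-weak-strategyproofness (sd-WSP).
   Context: Setting. An assignment problem has a set $N=\{1,\dots,n\}$ of agents and a set $M$ of $n$ items (one unit each). A preference profile $R=(\succ_j)_{j\in N}$ gives each agent $j$ a strict linear order $\succ_j$ on $M$. For nonempty $S\subseteq M$, $\mathrm{top}(j,S)$ is the $\succ_j$-best item of $S$; $rk(j,o)$ is the rank of $o$ in $\succ_j$ ($1$ = best). $U(\succ_j,o)=\{o'\in M:o'\succ_jo\}\cup\{o\}$. A random assignment is a doubly stochastic $n\times n$ matrix $P=[p_{j,o}]$ with rows $P_j$. A mechanism $f$ assigns to every preference profile (of every assignment problem, of any size $n$) a random assignment; it satisfies a property of random assignments if its output satisfies it for every profile. ea-FERI. Given $P$, put $M_{P,0}=\emptyset$ and $E_{P,0}(o)=\emptyset$ for all $o$. For $r=1,2,\dots$ define recursively $M_{P,r}=\{o\in M:\sum_{k\in\bigcup_{r'<r}E_{P,r'}(o)}p_{k,o}<1\}$ and, for $o\in M_{P,r}$, $E_{P,r}(o)=\{j\in N:o=\mathrm{top}(j,M_{P,r})\}$ (with $E_{P,r}(o)=\emptyset$ for $o\notin M_{P,r}$). $P$ satisfies ea-FERI if for every $r\ge1$, every $o\in M_{P,r}$ and every $j\in N$: if $j\in E_{P,r'}(o)$ for some $r'<r$, then $\sum_{o'\in U(\succ_j,o)}p_{j,o'}=1$. SETE: for agents $j,k$, their common prefix is the set $M'\subseteq M$ such that $rk(j,o)=rk(k,o)\le|M'|$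 for all $o\in M'$ and $\mathrm{top}(j,M\setminus M')\neq\mathrm{top}(k,M\setminus M')$ (with $M'=M$ if $\succ_j=\succ_k$). $P$ satisfies SETE if $p_{j,o}=p_{k,o}$ for all $j,k\in N$ and all $o$ in the common prefix of $j$ and $k$. Stochastic dominance. For probability vectors $p,q$ on $M$, $p\succeq^{sd}_jq$ means $\sum_{o'\in U(\succ_j,o)}p_{o'}\ge\sum_{o'\in U(\succ_j,o)}q_{o'}$ for all $o\in M$. sd-WSP: $f$ is sd-WSP if for every profile $R$, every $j\in N$ and every $R'=(\succ'_j,\succ_{-j})$ obtained from $R$ by changing only $j$'s preference, $f(R')_j\succeq^{sd}_jf(R)_j$ (with respect to $\succ_j$) implies $f(R')_j=f(R)_j$. *)

theory Defs
  imports Complex_Main "HOL-Library.FuncSet"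
begin

text \<open>
  An assignment problem is given by its finite nonempty set of items \<open>M\<close>; the agents are
  \<open>1, \<dots>, n\<close> with \<open>n = card M\<close>.
\<close>

definition is_problem :: "'o set \<Rightarrow> bool" where
  "is_problem M \<longleftrightarrow> finite M \<and> M \<noteq> {}"

definition agents :: "'o set \<Rightarrow> nat set" where
  "agents M = {1..card M}"

text \<open>
  \<open>(a, b) \<in> s\<close> means that \<open>a\<close> is strictly preferred to \<open>b\<close>. The library predicate
  does not confine \<open>s\<close> to \<open>M\<close>, so this is required in addition.
\<close>

definition preferences :: "'o set \<Rightarrow> 'o rel set" where
  "preferences M = {s. s \<subseteq> M \<times> M \<and> strict_linear_order_on M s}"

definition profiles :: "'o set \<Rightarrow> (nat \<Rightarrow> 'o rel) set" where
  "profiles M = (\<Pi>\<^sub>E j \<in> agents M. preferences M)"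

definition top_item :: "'o rel \<Rightarrow> 'o set \<Rightarrow> 'o" where
  "top_item s S = (THE x. x \<in> S \<and> (\<forall>y \<in> S - {x}. (x, y) \<in> s))"

definition upper :: "'o set \<Rightarrow> 'o rel \<Rightarrow> 'o \<Rightarrow> 'o set" where
  "upper M s x = {y \<in> M. (y, x) \<in> s} \<union> {x}"

definition rk :: "'o set \<Rightarrow> 'o rel \<Rightarrow> 'o \<Rightarrow> nat" where
  "rk M s x = card {y \<in> M. (y, x) \<in> s} + 1"

type_synonym 'o assignment = "nat \<Rightarrow> 'o \<Rightarrow> real"

text \<open>Only the entries \<open>P j x\<close> with \<open>j \<in> agents M\<close> and \<open>x \<in> M\<close> are meaningful.\<close>

definition random_assignment :: "'o set \<Rightarrow> 'o assignment \<Rightarrow> bool" where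
  "random_assignment M P \<longleftrightarrow>
     (\<forall>j \<in> agents M. \<forall>x \<in> M. 0 \<le> P j x) \<and>
     (\<forall>j \<in> agents M. (\<Sum>x \<in> M. P j x) = 1) \<and>
     (\<forall>x \<in> M. (\<Sum>j \<in> agents M. P j x) = 1)"

text \<open>The sets \<open>M\<^bsub>P,r\<^esub>\<close> and \<open>E\<^bsub>P,r\<^esub>(x)\<close>, by simultaneous recursion on \<open>r\<close>.\<close>

function remaining :: "'o set \<Rightarrow> (nat \<Rightarrow> 'o rel) \<Rightarrow> 'o assignment \<Rightarrow> nat \<Rightarrow> 'o set"
  and eager :: "'o set \<Rightarrow> (nat \<Rightarrow> 'o rel) \<Rightarrow> 'o assignment \<Rightarrow> nat \<Rightarrow> 'o \<Rightarrow> nat set"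
where
  "remaining M R P r =
     (if r = 0 then {}
      else {x \<in> M. (\<Sum>k \<in> (\<Union>r' \<in> {..<r}. eager M R P r' x). P k x) < 1})"
| "eager M R P r x =
     (if x \<in> remaining M R P r
      then {j \<in> agents M. x = top_item (R j) (remaining M R P r)} else {})"
  by pat_completeness auto
termination
  by (relation "measure (case_sum (\<lambda>(M, R, P, r). 2 * r) (\<lambda>(M, R, P, r, x). 2 * r + 1))") auto

text \<open>The recursion equations loop as rewrite rules.\<close>

declare remaining.simps [simp del] eager.simps [simp del]

definition ea_FERI :: "'o set \<Rightarrow> (nat \<Rightarrow> 'o rel) \<Rightarrow> 'o assignment \<Rightarrow> bool" where
  "ea_FERI M R P \<longleftrightarrow>
     (\<forall>r \<ge> 1. \<forall>x \<in> remaining M R P r. \<forall>j \<in> agents M.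
        (\<exists>r' < r. j \<in> eager M R P r' x) \<longrightarrow> (\<Sum>y \<in> upper M (R j) x. P j y) = 1)"

text \<open>
  For preferences \<open>s, t\<close> on a finite \<open>M\<close> exactly one \<open>M'\<close> has this property, so quantifying
  over all such \<open>M'\<close> amounts to speaking of the common prefix. If \<open>M' = M\<close> both calls of
  \<open>top_item\<close> return the same unspecified value; for \<open>s \<noteq> t\<close> this case is thereby excluded.
\<close>

definition is_common_prefix :: "'o set \<Rightarrow> 'o rel \<Rightarrow> 'o rel \<Rightarrow> 'o set \<Rightarrow> bool" where
  "is_common_prefix M s t M' \<longleftrightarrow>
     M' \<subseteq> M \<and>
     (\<forall>x \<in> M'. rk M s x = rk M t x \<and> rk M t x \<le> card M') \<and>
     (if s = t then M' = M else top_item s (M - M') \<noteq> top_item t (M - M'))"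

definition SETE :: "'o set \<Rightarrow> (nat \<Rightarrow> 'o rel) \<Rightarrow> 'o assignment \<Rightarrow> bool" where
  "SETE M R P \<longleftrightarrow>
     (\<forall>j \<in> agents M. \<forall>k \<in> agents M. \<forall>M'. is_common_prefix M (R j) (R k) M' \<longrightarrow>
        (\<forall>x \<in> M'. P j x = P k x))"

definition sd_dominates :: "'o set \<Rightarrow> 'o rel \<Rightarrow> ('o \<Rightarrow> real) \<Rightarrow> ('o \<Rightarrow> real) \<Rightarrow> bool" where
  "sd_dominates M s p q \<longleftrightarrow>
     (\<forall>x \<in> M. (\<Sum>y \<in> upper M s x. p y) \<ge> (\<Sum>y \<in> upper M s x. q y))"

text \<open>
  A mechanism takes the item set and the profile. It covers problems of every size if the
  type \<open>'o\<close> is infinite.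
\<close>

type_synonym 'o mechanism = "'o set \<Rightarrow> (nat \<Rightarrow> 'o rel) \<Rightarrow> 'o assignment"

definition is_mechanism :: "'o mechanism \<Rightarrow> bool" where
  "is_mechanism f \<longleftrightarrow>
     (\<forall>M. is_problem M \<longrightarrow> (\<forall>R \<in> profiles M. random_assignment M (f M R)))"

definition satisfies ::
    "'o mechanism \<Rightarrow> ('o set \<Rightarrow> (nat \<Rightarrow> 'o rel) \<Rightarrow> 'o assignment \<Rightarrow> bool) \<Rightarrow> bool" where
  "satisfies f Q \<longleftrightarrow> (\<forall>M. is_problem M \<longrightarrow> (\<forall>R \<in> profiles M. Q M R (f M R)))"

definition sd_WSP :: "'o mechanism \<Rightarrow> bool" where
  "sd_WSP f \<longleftrightarrow>
     (\<forall>M. is_problem M \<longrightarrow>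
       (\<forall>R \<in> profiles M. \<forall>j \<in> agents M. \<forall>s \<in> preferences M.
          sd_dominates M (R j) (f M (R(j := s)) j) (f M R j) \<longrightarrow>
          (\<forall>x \<in> M. f M (R(j := s)) j x = f M R j x)))"

end

theory Submission
  imports Defs "HOL-Library.Sublist"
begin

text \<open>
  Five agents and items \<open>a, b, c, d, e\<close>. Agents 2, 3, 4 rank \<open>a e c d b\<close>, agent 5 ranks
  \<open>a b e c d\<close>, and agent 1 truthfully ranks \<open>a e b c d\<close>. In rounds 1 and 2 everybody gets \<open>1/5\<close>
  of \<open>a\<close>, agents 1 to 4 share \<open>e\<close>, and agent 5 fills up with \<open>4/5\<close> of \<open>b\<close>. In round 3 agent 1
  takes what is left of \<open>b\<close>, too little to satisfy it, while the others exhaust \<open>c\<close>. If agent 1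
  reports \<open>a e c b d\<close> instead, it shares \<open>c\<close> equally in round 3 and still gets all that is left
  of \<open>b\<close> in round 4, because nobody else who is not yet satisfied competes for \<open>b\<close>. So the
  misreport moves \<open>1/4\<close> from \<open>d\<close> to \<open>c\<close>.
\<close>

section \<open>Rankings as lists, best item first\<close>

fun pref :: "'o list \<Rightarrow> 'o rel" where
  "pref [] = {}"
| "pref (x # xs) = {x} \<times> set xs \<union> pref xs"

lemma pref_append: "pref (xs @ ys) = pref xs \<union> set xs \<times> set ys \<union> pref ys"
  by (induction xs) auto

lemma pref_subset: "pref xs \<subseteq> set xs \<times> set xs"
  by (induction xs) auto

lemma pref_preferences:
  assumes "distinct xs"
  shows "pref xs \<in> preferences (set xs)"
proof -
  have "trans (pref xs) \<and> irrefl (pref xs) \<and> total_on (set xs) (pref xs)"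
    using assms
  proof (induction xs)
    case (Cons x xs)
    then have IH: "trans (pref xs)" "irrefl (pref xs)" "total_on (set xs) (pref xs)"
      and "x \<notin> set xs" by auto
    moreover have sub: "y \<in> set xs \<and> z \<in> set xs" if "(y, z) \<in> pref xs" for y z
      using that pref_subset[of xs] by auto
    moreover have "trans (pref (x # xs))"
    proof (rule transI)
      fix y z w assume "(y, z) \<in> pref (x # xs)" "(z, w) \<in> pref (x # xs)"
      then show "(y, w) \<in> pref (x # xs)"
        using \<open>x \<notin> set xs\<close> by (auto dest: sub transD[OF IH(1)])
    qed
    ultimately show ?case by (auto simp: irrefl_def total_on_def)
  qed (auto simp: trans_def irrefl_def)
  then show ?thesis
    using pref_subset[of xs] by (simp add: preferences_def strict_linear_order_on_def)
qed

text \<open>Upper sets, ranks and top items are all read off a split \<open>ps @ x # qs\<close> of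
  the ranking through this equivalence.\<close>

lemma better_pref:
  assumes "distinct (ps @ x # qs)"
  shows "(y, x) \<in> pref (ps @ x # qs) \<longleftrightarrow> y \<in> set ps"
  using assms pref_subset[of ps] pref_subset[of qs] by (auto simp: pref_append)

lemma upper_pref:
  assumes "distinct (ps @ x # qs)" "set (ps @ x # qs) \<subseteq> M"
  shows "upper M (pref (ps @ x # qs)) x = insert x (set ps)"
  using assms better_pref[OF assms(1)] by (auto simp: upper_def)

lemma rk_pref:
  assumes "distinct (ps @ x # qs)" "set (ps @ x # qs) \<subseteq> M"
  shows "rk M (pref (ps @ x # qs)) x = length ps + 1"
proof -
  have "{y \<in> M. (y, x) \<in> pref (ps @ x # qs)} = set ps"
    using assms better_pref[OF assms(1)] by auto
  then show ?thesis
    using assms by (simp add: rk_def distinct_card)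
qed

lemma top_item_pref:
  assumes "distinct (ps @ x # qs)" "set ps \<inter> S = {}" "x \<in> S" "S \<subseteq> set (ps @ x # qs)"
  shows "top_item (pref (ps @ x # qs)) S = x"
  unfolding top_item_def
proof (rule the_equality)
  show "x \<in> S \<and> (\<forall>y\<in>S - {x}. (x, y) \<in> pref (ps @ x # qs))"
    using assms by (auto simp: pref_append)
next
  fix z assume z: "z \<in> S \<and> (\<forall>y\<in>S - {z}. (z, y) \<in> pref (ps @ x # qs))"
  show "z = x"
  proof (rule ccontr)
    assume "z \<noteq> x"
    \<comment> \<open>A second maximum \<open>z\<close> would beat \<open>x\<close>, hence lie in
      \<open>ps\<close>, which is disjoint from \<open>S\<close>.\<close>
    with z assms have "(z, x) \<in> pref (ps @ x # qs)" by auto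
    with z assms better_pref[OF assms(1)] show False by auto
  qed
qed

section \<open>SETE and ea-FERI for list rankings\<close>

declare pref.simps [simp del]

text \<open>The longest common list prefix, as a set, is the common prefix: its items have equal
  positions, and the entries after it differ. It contains \<open>ps\<close>, so applications may
  exhibit any shared initial segment without checking maximality.\<close>

lemma SETE_pref:
  assumes sete: "SETE M R P" and jk: "j \<in> agents M" "k \<in> agents M"
    and Rj: "R j = pref (ps @ xs)" "distinct (ps @ xs)" "set (ps @ xs) = M"
    and Rk: "R k = pref (ps @ ys)" "distinct (ps @ ys)" "set (ps @ ys) = M"
    and x: "x \<in> set ps"
  shows "P j x = P k x"
proof -
  let ?xs = "ps @ xs" and ?ys = "ps @ ys"
  define qs where "qs = longest_common_prefix ?xs ?ys"
  obtain us where us: "?xs = qs @ us"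
    using longest_common_prefix_prefix1[of ?xs ?ys] by (auto simp: prefix_def qs_def)
  obtain vs where vs: "?ys = qs @ vs"
    using longest_common_prefix_prefix2[of ?xs ?ys] by (auto simp: prefix_def qs_def)
  have "prefix ps qs"
    unfolding qs_def by (rule longest_common_prefix_max_prefix) auto
  with x have x_qs: "x \<in> set qs" by (auto simp: prefix_def)
  have M: "finite M" "set (qs @ us) = M" "set (qs @ vs) = M"
    "distinct (qs @ us)" "distinct (qs @ vs)"
    using Rj Rk us vs by auto
  have ranks: "rk M (R j) z = rk M (R k) z \<and> rk M (R k) z \<le> card (set qs)"
    if z_qs: "z \<in> set qs" for z
  proof -
    obtain as bs where z: "qs = as @ z # bs" using split_list[OF z_qs] by blast
    have "rk M (R j) z = length as + 1"
      using rk_pref[of as z "bs @ us" M] M Rj us by (auto simp: z)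
    moreover have "rk M (R k) z = length as + 1"
      using rk_pref[of as z "bs @ vs" M] M Rk vs by (auto simp: z)
    moreover have "card (set qs) = length qs"
      using M by (simp add: distinct_card)
    ultimately show ?thesis using z by simp
  qed
  have "is_common_prefix M (R j) (R k) (set qs)"
  proof (cases "us = [] \<or> vs = []")
    case True
    \<comment> \<open>Both rankings enumerate \<open>M\<close> without repetition, so neither
      remainder can be empty alone.\<close>
    have "set us = set vs" using M by auto
    with True have "us = []" "vs = []" by auto
    then have "R j = R k" "set qs = M" using Rj Rk us vs M by auto
    then show ?thesis using ranks by (simp add: is_common_prefix_def)
  next
    case False
    then obtain u us' v vs' where uv: "us = u # us'" "vs = v # vs'"
      by (meson neq_Nil_conv)
    have "u \<noteq> v"
    proof
      assume "u = v"
      then have "prefix (qs @ [u]) (longest_common_prefix ?xs ?ys)"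
        by (intro longest_common_prefix_max_prefix) (auto simp: us vs uv)
      then show False by (simp add: qs_def[symmetric] prefix_def)
    qed
    moreover have "top_item (R j) (M - set qs) = u"
      unfolding Rj us uv by (rule top_item_pref) (use M uv in auto)
    moreover have "top_item (R k) (M - set qs) = v"
      unfolding Rk vs uv by (rule top_item_pref) (use M uv in auto)
    ultimately show ?thesis
      using ranks M by (auto simp: is_common_prefix_def)
  qed
  with sete jk x_qs show ?thesis by (auto simp: SETE_def)
qed

text \<open>This form is used in two ways: to read off the share of an agent whose item survives,
  and to refute survival when the forced shares exceed the supply.\<close>

lemma ea_FERI_pref:
  assumes "ea_FERI M R P" "x \<in> remaining M R P r" "r' < r" "j \<in> eager M R P r' x"
    and "R j = pref (ps @ x # qs)" "distinct (ps @ x # qs)" "set (ps @ x # qs) = M"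
  shows "P j x + (\<Sum>y\<leftarrow>ps. P j y) = 1"
proof -
  have "j \<in> agents M"
    using assms(4) by (auto simp: eager.simps split: if_splits)
  moreover have "r \<ge> 1" using assms(3) by simp
  ultimately have "(\<Sum>y \<in> upper M (R j) x. P j y) = 1"
    using assms(1-4) unfolding ea_FERI_def by blast
  moreover have "upper M (R j) x = insert x (set ps)"
    unfolding assms(5) by (rule upper_pref) (use assms in auto)
  ultimately show ?thesis
    using assms(6) by (simp add: sum_list_distinct_conv_sum_set)
qed

section \<open>The five-agent problem, with agent 1's report left open below
  \<open>e\<close>\<close>

lemma lessThan_nat_numerals:
  "{..<1} = {0::nat}" "{..<2} = {0, 1::nat}" "{..<3} = {0, 1, 2::nat}"
  "{..<4} = {0, 1, 2, 3::nat}" "{..<5} = {0, 1, 2, 3, 4::nat}"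
  by auto

text \<open>Agent 1's ranking below \<open>e\<close>, the list \<open>u\<close>, is where truth and misreport differ.\<close>

locale five_agents =
  fixes a b c d e :: 'o and M R P and u :: "'o list"
  assumes dist: "distinct [a, b, c, d, e]" and M: "M = {a, b, c, d, e}"
    and R1: "R 1 = pref (a # e # u)" "distinct (a # e # u)" "set (a # e # u) = M"
    and R234: "R 2 = pref [a, e, c, d, b]" "R 3 = pref [a, e, c, d, b]" "R 4 = pref [a, e, c, d, b]"
    and R5: "R 5 = pref [a, b, e, c, d]"
    and ra: "random_assignment M P" and feri: "ea_FERI M R P" and sete: "SETE M R P"
begin

declare One_nat_def [simp del]

lemma mem: "x \<in> M \<longleftrightarrow> x \<in> {a, b, c, d, e}"
  by (simp add: M)

lemma neq [simp]:
  "a \<noteq> b" "a \<noteq> c" "a \<noteq> d" "a \<noteq> e" "b \<noteq> a" "b \<noteq> c" "b \<noteq> d" "b \<noteq> e" "c \<noteq> a" "c \<noteq> b"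
  "c \<noteq> d" "c \<noteq> e" "d \<noteq> a" "d \<noteq> b" "d \<noteq> c" "d \<noteq> e" "e \<noteq> a" "e \<noteq> b" "e \<noteq> c" "e \<noteq> d"
  using dist by auto

lemma agents: "agents M = {1, 2, 3, 4, 5}"
proof -
  have "card M = 5" using dist by (simp add: M)
  then show ?thesis by (auto simp: agents_def)
qed

lemma nonneg: "j \<in> {1, 2, 3, 4, 5} \<Longrightarrow> x \<in> M \<Longrightarrow> 0 \<le> P j x"
  using ra unfolding random_assignment_def agents by auto

lemma row: "j \<in> {1, 2, 3, 4, 5} \<Longrightarrow> P j a + P j b + P j c + P j d + P j e = 1"
  using ra dist unfolding random_assignment_def agents by (auto simp: M add.assoc)

lemma column: "x \<in> M \<Longrightarrow> P 1 x + P 2 x + P 3 x + P 4 x + P 5 x = 1"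
  using ra unfolding random_assignment_def agents by (simp add: add.assoc)

lemma equal_234:
  assumes "x \<in> M"
  shows "P 2 x = P 3 x" "P 2 x = P 4 x"
  by (rule SETE_pref[OF sete, of _ _ "[a, e, c, d, b]" "[]" "[]"];
    use assms R234 dist in \<open>auto simp: agents mem\<close>)+

text \<open>Since \<open>u\<close> is open, the shared segment is a parameter: \<open>[a]\<close>
  and \<open>[a, e]\<close> serve for both reports, \<open>[a, e, c]\<close> only for the
  misreport.\<close>

lemma equal_1_2:
  assumes "a # e # u = ps @ xs" "[a, e, c, d, b] = ps @ ys" "x \<in> set ps"
  shows "P 1 x = P 2 x"
proof (rule SETE_pref[OF sete, of 1 2 ps xs ys])
  have "set [a, e, c, d, b] = M" "distinct [a, e, c, d, b]" using dist mem by auto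
  then show "set (ps @ ys) = M" "distinct (ps @ ys)" by (simp_all only: assms(2))
qed (use R1 R234 assms in \<open>simp_all add: agents\<close>)

text \<open>All rankings start with \<open>a\<close>, so SETE makes its column constant.\<close>

lemma share_a: "j \<in> {1, 2, 3, 4, 5} \<Longrightarrow> P j a = 1 / 5"
proof -
  have "P 1 a = P 2 a"
    by (rule equal_1_2[of "[a]" "e # u" "[e, c, d, b]"]) simp_all
  moreover have "P 2 a = P 5 a"
    by (rule SETE_pref[OF sete, of 2 5 "[a]" "[e, c, d, b]" "[b, e, c, d]"])
      (use R234 R5 dist in \<open>auto simp: agents mem\<close>)
  moreover assume "j \<in> {1, 2, 3, 4, 5}"
  ultimately show ?thesis
    using column[of a] equal_234[of a] by (auto simp: mem)
qed

lemma top_1: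
  assumes "a # e # u = ps @ x # qs" "set ps \<inter> S = {}" "x \<in> S" "S \<subseteq> M"
  shows "top_item (R 1) S = x"
  unfolding R1 assms(1) by (rule top_item_pref) (use assms R1 in auto)

lemma top_234:
  assumes "j \<in> {2, 3, 4}" "[a, e, c, d, b] = ps @ x # qs" "set ps \<inter> S = {}" "x \<in> S" "S \<subseteq> M"
  shows "top_item (R j) S = x"
proof -
  have "R j = pref (ps @ x # qs)" using assms R234 by auto
  moreover have "top_item (pref (ps @ x # qs)) S = x"
    by (rule top_item_pref) (use assms(3-5) assms(2)[symmetric] dist in \<open>auto simp: mem\<close>)
  ultimately show ?thesis by simp
qed

lemma top_5:
  assumes "[a, b, e, c, d] = ps @ x # qs" "set ps \<inter> S = {}" "x \<in> S" "S \<subseteq> M"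
  shows "top_item (R 5) S = x"
  unfolding R5 assms(1)
  by (rule top_item_pref) (use assms(2-4) assms(1)[symmetric] dist in \<open>auto simp: mem\<close>)

section \<open>Rounds 1 and 2, and consequences common to both reports\<close>

lemma eager_iff:
  "j \<in> eager M R P r x \<longleftrightarrow>
    x \<in> remaining M R P r \<and> j \<in> {1, 2, 3, 4, 5} \<and> top_item (R j) (remaining M R P r) = x"
  by (subst eager.simps) (auto simp: agents)

lemma remaining_numeral_iff:
  "x \<in> remaining M R P (numeral r) \<longleftrightarrow>
    x \<in> M \<and> (\<Sum>k \<in> (\<Union>r' \<in> {..<numeral r}. eager M R P r' x). P k x) < 1"
  by (subst remaining.simps) simp

lemma eager_0: "eager M R P 0 x = {}"
  by (simp add: eager.simps remaining.simps)

lemma remaining_1: "remaining M R P 1 = M"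
  by (subst remaining.simps) (simp add: eager_0 lessThan_nat_numerals)

lemma eager_1: "eager M R P 1 x = (if x = a then {1, 2, 3, 4, 5} else {})"
proof -
  have "top_item (R j) M = a" if "j \<in> {1, 2, 3, 4, 5}" for j
    using that top_1[of "[]" a "e # u" M] top_234[of j "[]" a "[e, c, d, b]" M]
      top_5[of "[]" a "[b, e, c, d]" M] by (auto simp: mem)
  then have "j \<in> eager M R P 1 x \<longleftrightarrow> x = a \<and> j \<in> {1, 2, 3, 4, 5}" for j
    unfolding eager_iff remaining_1 using mem by blast
  then show ?thesis by auto
qed

text \<open>Round 0 contributes nobody. Round 5 is the last one needed, to decide whether
  \<open>b\<close> survives round 4.\<close>

lemma remaining_step_iff:
  "x \<in> remaining M R P 2 \<longleftrightarrow> x \<in> M \<and> (\<Sum>k \<in> eager M R P 1 x. P k x) < 1"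
  "x \<in> remaining M R P 3 \<longleftrightarrow>
    x \<in> M \<and> (\<Sum>k \<in> eager M R P 1 x \<union> eager M R P 2 x. P k x) < 1"
  "x \<in> remaining M R P 4 \<longleftrightarrow>
    x \<in> M \<and> (\<Sum>k \<in> eager M R P 1 x \<union> eager M R P 2 x \<union> eager M R P 3 x. P k x) < 1"
  "x \<in> remaining M R P 5 \<longleftrightarrow>
    x \<in> M \<and> (\<Sum>k \<in> eager M R P 1 x \<union> eager M R P 2 x \<union> eager M R P 3 x
      \<union> eager M R P 4 x. P k x) < 1"
  by (simp_all add: remaining_numeral_iff lessThan_nat_numerals eager_0 Un_assoc)

lemma remaining_2: "remaining M R P 2 = {b, c, d, e}"
proof -
  have "x \<in> remaining M R P 2 \<longleftrightarrow> x \<in> {b, c, d, e}" for x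
    by (auto simp: remaining_step_iff(1) eager_1 mem share_a)
  then show ?thesis by blast
qed

lemma eager_2:
  "eager M R P 2 x = (if x = e then {1, 2, 3, 4} else if x = b then {5} else {})"
proof -
  have 1: "top_item (R 1) {b, c, d, e} = e"
    by (rule top_1[of "[a]" _ u]) (auto simp: mem)
  have 2: "top_item (R j) {b, c, d, e} = e" if "j \<in> {2, 3, 4}" for j
    by (rule top_234[OF that, of "[a]" _ "[c, d, b]"]) (auto simp: mem)
  have 5: "top_item (R 5) {b, c, d, e} = b"
    by (rule top_5[of "[a]" _ "[e, c, d]"]) (auto simp: mem)
  show ?thesis
    using 1 2[of 2] 2[of 3] 2[of 4] 5 by (auto simp: eager_iff remaining_2)
qed

text \<open>SETE equalises the shares of agents 1 to 4. If \<open>e\<close> survived round 2,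
  ea-FERI would give each of them \<open>4/5\<close>, more than the supply. So these four exhaust
  \<open>e\<close>, and nothing is left for agent 5.\<close>

lemma share_e: "j \<in> {1, 2, 3, 4} \<Longrightarrow> P j e = 1 / 4" "e \<notin> remaining M R P 3"
proof -
  have "P 1 e = P 2 e"
    by (rule equal_1_2[of "[a, e]" u "[c, d, b]"]) simp_all
  then have eq: "P 1 e = P 2 e" "P 3 e = P 2 e" "P 4 e = P 2 e"
    using equal_234[of e] by (auto simp: mem)
  show e3: "e \<notin> remaining M R P 3"
  proof
    assume "e \<in> remaining M R P 3"
    then have "P 1 e + (\<Sum>y\<leftarrow>[a]. P 1 y) = 1"
      by (rule ea_FERI_pref[OF feri, where r' = 2 and qs = u]) (use R1 in \<open>auto simp: eager_2\<close>)
    then show False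
      using share_a column[of e] eq nonneg[of 5 e] by (simp add: mem)
  qed
  assume "j \<in> {1, 2, 3, 4}"
  moreover have "P 2 e \<ge> 1 / 4"
    using e3 eq by (simp add: remaining_step_iff(2) eager_1 eager_2 mem)
  ultimately show "P j e = 1 / 4"
    using eq column[of e] nonneg[of 5 e] by (auto simp: mem)
qed

lemma remaining_3: "remaining M R P 3 = {b, c, d}"
proof -
  \<comment> \<open>Agent 5 is alone on \<open>b\<close> in round 2 and already holds
    \<open>1/5\<close> of \<open>a\<close>, so it cannot exhaust \<open>b\<close>.\<close>
  have "P 5 b < 1"
    using row[of 5] share_a[of 5] nonneg[of 5 c] nonneg[of 5 d] nonneg[of 5 e] by (simp add: mem)
  then have "x \<in> remaining M R P 3 \<longleftrightarrow> x \<in> {b, c, d}" for x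
    using share_e(2) by (auto simp: remaining_step_iff(2) eager_1 eager_2 mem share_a)
  then show ?thesis by blast
qed

text \<open>As \<open>b\<close> survives round 2, ea-FERI makes agent 5 draw its whole unit from
  \<open>a\<close> and \<open>b\<close>.\<close>

lemma share_5_b: "P 5 b = 4 / 5"
proof -
  have "P 5 b + (\<Sum>y\<leftarrow>[a]. P 5 y) = 1"
    by (rule ea_FERI_pref[OF feri, where r' = 2 and r = 3 and qs = "[e, c, d]"])
      (auto simp: R5 eager_2 remaining_3 mem)
  then show ?thesis using share_a[of 5] by simp
qed

lemma top_3:
  "j \<in> {2, 3, 4} \<Longrightarrow> top_item (R j) {b, c, d} = c"
  "top_item (R 5) {b, c, d} = b"
  by (rule top_234[of _ "[a, e]" _ "[d, b]"] top_5[of "[a]" _ "[e, c, d]"]; auto simp: mem)+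

text \<open>Agents 2, 3, 4 are eager for \<open>c\<close> in round 3 under either report. Survival
  of \<open>c\<close> would give each of them \<open>1 - 1/5 - 1/4 = 11/20\<close>, which is too
  much for three agents.\<close>

lemma c_exhausted: "c \<notin> remaining M R P 4"
proof
  assume "c \<in> remaining M R P 4"
  moreover have "2 \<in> eager M R P 3 c"
    by (simp add: eager_iff remaining_3 top_3)
  ultimately have "P 2 c + (\<Sum>y\<leftarrow>[a, e]. P 2 y) = 1"
    by (intro ea_FERI_pref[OF feri, where r = 4 and r' = 3 and qs = "[d, b]"])
      (auto simp: R234 mem)
  then have "P 2 c = 11 / 20" using share_a[of 2] share_e(1)[of 2] by simp
  then show False
    using column[of c] equal_234[of c] nonneg[of 1 c] nonneg[of 5 c] by (simp add: mem)
qed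

section \<open>Agent 1's shares of \<open>b\<close> and \<open>c\<close> under each report\<close>

text \<open>Agent 5 leaves at most \<open>1/5\<close> of \<open>b\<close>; this bound is enough for
  the later dominance. Agent 1 turns to \<open>b\<close> in round 3, so \<open>c\<close> is
  exhausted by agents 2, 3, 4 alone.\<close>

lemma truthful_shares:
  assumes "u = [b, c, d]"
  shows "P 1 b \<le> 1 / 5" "P 1 c = 0"
proof -
  show "P 1 b \<le> 1 / 5"
    using column[of b] share_5_b nonneg[of 2 b] nonneg[of 3 b] nonneg[of 4 b] by (simp add: mem)
  have "top_item (R 1) {b, c, d} = b"
    by (rule top_1[of "[a, e]" _ "[c, d]"]) (use assms in \<open>auto simp: mem\<close>)
  then have "eager M R P 3 c = {2, 3, 4}"
    by (auto simp: eager_iff remaining_3 top_3)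
  then have "P 2 c + P 3 c + P 4 c \<ge> 1"
    using c_exhausted by (simp add: remaining_step_iff(3) eager_1 eager_2 mem add.assoc)
  then show "P 1 c = 0"
    using column[of c] nonneg[of 1 c] nonneg[of 5 c] by (simp add: mem)
qed

lemma manipulated_shares:
  assumes "u = [c, b, d]"
  shows "P 1 b = 1 / 5" "P 1 c = 1 / 4"
proof -
  \<comment> \<open>The misreport extends the segment shared with agent 2 to \<open>c\<close>, so
    SETE now covers \<open>c\<close>.\<close>
  have eq: "P 1 c = P 2 c"
    by (rule equal_1_2[of "[a, e, c]" "[b, d]" "[d, b]"]) (simp_all add: assms)
  have "top_item (R 1) {b, c, d} = c"
    by (rule top_1[of "[a, e]" _ "[b, d]"]) (use assms in \<open>auto simp: mem\<close>)
  then have e3: "eager M R P 3 x = (if x = c then {1, 2, 3, 4} else if x = b then {5} else {})" for x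
    by (auto simp: eager_iff remaining_3 top_3)
  then have "P 1 c + P 2 c + P 3 c + P 4 c \<ge> 1"
    using c_exhausted by (simp add: remaining_step_iff(3) eager_1 eager_2 mem add.assoc)
  then show c: "P 1 c = 1 / 4"
    using eq column[of c] equal_234[of c] nonneg[of 5 c] by (simp add: mem)
  \<comment> \<open>Only agent 5, with \<open>4/5\<close>, has been eager for \<open>b\<close> so
    far, and nobody for \<open>d\<close>.\<close>
  have rem4: "remaining M R P 4 = {b, d}"
  proof -
    have "x \<in> remaining M R P 4 \<longleftrightarrow> x \<in> {b, d}" for x
      using c_exhausted
      by (auto simp: remaining_step_iff(3) eager_1 eager_2 e3 mem share_a share_e share_5_b)
    then show ?thesis by blast
  qed
  have 1: "top_item (R 1) {b, d} = b"
    by (rule top_1[of "[a, e, c]" _ "[d]"]) (use assms in \<open>auto simp: mem\<close>)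
  have 2: "top_item (R j) {b, d} = d" if "j \<in> {2, 3, 4}" for j
    by (rule top_234[OF that, of "[a, e, c]" _ "[b]"]) (auto simp: mem)
  have 5: "top_item (R 5) {b, d} = b"
    by (rule top_5[of "[a]" _ "[e, c, d]"]) (auto simp: mem)
  have e4: "eager M R P 4 b = {1, 5}"
    using 1 2[of 2] 2[of 3] 2[of 4] 5 by (auto simp: eager_iff rem4)
  have le: "P 1 b \<le> 1 / 5"
    using column[of b] share_5_b nonneg[of 2 b] nonneg[of 3 b] nonneg[of 4 b] by (simp add: mem)
  \<comment> \<open>Survival would force \<open>1 - 1/5 - 1/4 - 1/4 = 3/10\<close> of
    \<open>b\<close> on agent 1, above the \<open>1/5\<close> available.\<close>
  have "b \<notin> remaining M R P 5"
  proof
    assume "b \<in> remaining M R P 5"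
    then have "P 1 b + (\<Sum>y\<leftarrow>[a, e, c]. P 1 y) = 1"
      by (rule ea_FERI_pref[OF feri, where r' = 4 and qs = "[d]"])
        (use R1 assms e4 in auto)
    then show False using le c share_a[of 1] share_e(1)[of 1] by simp
  qed
  then have "P 1 b + P 5 b \<ge> 1"
    by (simp add: remaining_step_iff(4) eager_1 eager_2 e3 e4 mem insert_commute)
  then show "P 1 b = 1 / 5" using le share_5_b by simp
qed

end

section \<open>The profitable misreport\<close>

theorem proposition7:
  assumes "infinite (UNIV :: 'o set)"
  shows "\<not> (\<exists>f :: 'o mechanism.
            is_mechanism f \<and> satisfies f ea_FERI \<and> satisfies f SETE \<and> sd_WSP f)"
proof
  assume "\<exists>f :: 'o mechanism.
            is_mechanism f \<and> satisfies f ea_FERI \<and> satisfies f SETE \<and> sd_WSP f"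
  then obtain f :: "'o mechanism" where f: "is_mechanism f" "satisfies f ea_FERI"
    "satisfies f SETE" "sd_WSP f" by blast
  obtain B :: "'o set" where "finite B" "card B = 5"
    using infinite_arbitrarily_large[OF assms] by blast
  then obtain xs :: "'o list" where xs: "length xs = 5" "distinct xs"
    using finite_distinct_list distinct_card by metis
  then have "length xs = Suc (Suc (Suc (Suc (Suc 0))))" by simp
  then obtain a b c d e :: 'o where "xs = [a, b, c, d, e]"
    unfolding length_Suc_conv by auto
  with xs have dist: "distinct [a, b, c, d, e]" by simp
  define M where "M = {a, b, c, d, e}"
  \<comment> \<open>The abstraction is restricted because \<open>profiles\<close> is an extensional
    function space.\<close>
  define R where "R = (\<lambda>j \<in> agents M. if j = 1 then pref [a, e, b, c, d]
    else if j = 5 then pref [a, b, e, c, d] else pref [a, e, c, d, b])"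
  define s where "s = pref [a, e, c, b, d]"
  have card: "card M = 5" using dist by (simp add: M_def)
  have problem: "is_problem M" by (simp add: is_problem_def M_def)
  have pref_M: "pref ys \<in> preferences M" if "distinct ys" "set ys = M" for ys
    using pref_preferences that by blast
  have prefs: "pref [a, e, b, c, d] \<in> preferences M" "pref [a, b, e, c, d] \<in> preferences M"
    "pref [a, e, c, d, b] \<in> preferences M" "s \<in> preferences M"
    unfolding s_def by (rule pref_M; use dist in \<open>auto simp: M_def\<close>)+
  have R: "R \<in> profiles M"
    unfolding R_def profiles_def using prefs by (auto)
  have R': "R(1 := s) \<in> profiles M"
    using R prefs card unfolding profiles_def
    by (auto simp: agents_def PiE_iff extensional_def)
  have axioms: "random_assignment M (f M Q) \<and> ea_FERI M Q (f M Q) \<and> SETE M Q (f M Q)"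
    if "Q \<in> profiles M" for Q
    using f problem that by (simp add: is_mechanism_def satisfies_def)
  have R_eq: "R 1 = pref [a, e, b, c, d]" "R 2 = pref [a, e, c, d, b]"
    "R 3 = pref [a, e, c, d, b]" "R 4 = pref [a, e, c, d, b]" "R 5 = pref [a, b, e, c, d]"
    by (simp_all add: R_def agents_def card)
  \<comment> \<open>The locale is used twice, as \<open>t\<close> for the truthful profile and as
    \<open>m\<close> for the misreport.\<close>
  interpret t: five_agents a b c d e M R "f M R" "[b, c, d]"
    by unfold_locales (use dist R_eq axioms[OF R] in \<open>auto simp: M_def\<close>)
  interpret m: five_agents a b c d e M "R(1 := s)" "f M (R(1 := s))" "[c, b, d]"
    by unfold_locales (use dist R_eq axioms[OF R'] in \<open>auto simp: M_def s_def\<close>)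
  \<comment> \<open>Along the true ranking the cumulative shares agree at \<open>a\<close>,
    \<open>e\<close> and \<open>d\<close>. At \<open>b\<close> the misreport is at least as good,
    and at \<open>c\<close> it gains at least \<open>1/4\<close>.\<close>
  have "sd_dominates M (R 1) (f M (R(1 := s)) 1) (f M R 1)"
  proof -
    have "upper M (R 1) a = {a}" "upper M (R 1) e = {a, e}" "upper M (R 1) b = {a, e, b}"
      "upper M (R 1) c = {a, e, b, c}" "upper M (R 1) d = {a, e, b, c, d}"
      using upper_pref[of "[]" a "[e, b, c, d]" M] upper_pref[of "[a]" e "[b, c, d]" M]
        upper_pref[of "[a, e]" b "[c, d]" M] upper_pref[of "[a, e, b]" c "[d]" M]
        upper_pref[of "[a, e, b, c]" d "[]" M]
      unfolding t.R1(1) by (simp_all add: t.mem insert_commute)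
    then show ?thesis
      using dist t.share_a[of 1] t.share_e(1)[of 1] t.truthful_shares t.row[of 1]
        m.share_a[of 1] m.share_e(1)[of 1] m.manipulated_shares m.row[of 1]
      by (simp add: sd_dominates_def t.M)
  qed
  \<comment> \<open>sd-WSP turns dominance into equality, but the shares of \<open>c\<close> are
    \<open>1/4\<close> and \<open>0\<close>.\<close>
  then have "f M (R(1 := s)) 1 c = f M R 1 c"
    using f(4) R prefs problem card unfolding sd_WSP_def by (auto simp: agents_def M_def)
  then show False
    using t.truthful_shares(2) m.manipulated_shares(2) by simp
qed

end
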